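(* For every $n\ge 5$ and every $\sigma\in CK_n$ there is some $\pi\in \mathrm{orb}([31425])\cup \mathrm{orb}([24135])$ such that $\pi\preceq\sigma$.
   Context: $S_n$ is the set of permutations of $\{1,\dots,n\}$, written in one-line notation $\sigma=[\sigma_1,\dots,\sigma_n]$. For $n\ge 2$, $CK_n$ is the set of cylindrical king permutations of order $n$: those $\sigma\in S_n$ with $|\sigma_{i+1}-\sigma_i|>1$ for all $1\le i\le n-1$ and $|\sigma_1-\sigma_n|>1$. For $\sigma\in S_n$, $\pi\in S_k$ with $k<n$, write $\pi\prec\sigma$ if the one-line notation of $\sigma$ has a (not necessarily consecutive) subsequence order-isomorphic to $\pi$; $\pi\preceq\sigma$ means $\pi\prec\sigma$ or $\pi=\sigma$. Let $C_n$ be the cyclic subgroup of $S_n$ generated by the cycle $(1\,2\,\cdots\,n)$. Write $\sigma\sim\tau$ for $\sigma,\tau\in S_n$ if $\tau=\sigma\cdot\rho$ for some $\rho\in C_n$ (that is, the one-line notation of $\tau$ is a cyclic rotation of that of $\sigma$). $\mathrm{orb}(\sigma)$ denotes the equivalence class of $\sigma$. For example, $\mathrm{orb}([23154])=\{[23154],[31542],[15423],[54231],[42315]\}$. *)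

theory Defs
  imports "HOL-Algebra.Sym_Groups" "HOL-Algebra.Multiplicative_Group" "HOL-Library.Sublist"
begin

text \<open>
  A permutation in \<open>S\<^sub>n\<close> is an element of the library's symmetric group \<^const>\<open>sym_group\<close>, that is, a
  function on \<^typ>\<open>nat\<close> permuting \<open>{1..n}\<close> and fixing every other number. The order \<open>n\<close> is not
  recoverable from such a function, so it is passed explicitly wherever it matters.
\<close>

definition one_line :: "nat \<Rightarrow> (nat \<Rightarrow> nat) \<Rightarrow> nat list" where
  "one_line n \<sigma> = map \<sigma> [1..<Suc n]"

text \<open>The permutation with a given one-line notation, of order the length of the list.\<close>

definition perm_of :: "nat list \<Rightarrow> nat \<Rightarrow> nat" where
  "perm_of xs i = (if 1 \<le> i \<and> i \<le> length xs then xs ! (i - 1) else i)"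

text \<open>Differences are taken in \<^typ>\<open>int\<close> because subtraction on \<^typ>\<open>nat\<close> truncates.\<close>

definition CK :: "nat \<Rightarrow> (nat \<Rightarrow> nat) set" where
  "CK n = {\<sigma> \<in> carrier (sym_group n).
     (\<forall>i\<in>{1..n - 1}. \<bar>int (\<sigma> (i + 1)) - int (\<sigma> i)\<bar> > 1) \<and> \<bar>int (\<sigma> 1) - int (\<sigma> n)\<bar> > 1}"

definition order_isomorphic :: "nat list \<Rightarrow> nat list \<Rightarrow> bool" where
  "order_isomorphic xs ys \<longleftrightarrow> length xs = length ys \<and>
     (\<forall>i<length xs. \<forall>j<length xs. xs ! i < xs ! j \<longleftrightarrow> ys ! i < ys ! j)"

text \<open>In the next two definitions, \<open>\<pi>\<close> has order \<open>k\<close> and \<open>\<sigma>\<close> has order \<open>n\<close>.\<close>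

definition pattern_less :: "nat \<Rightarrow> (nat \<Rightarrow> nat) \<Rightarrow> nat \<Rightarrow> (nat \<Rightarrow> nat) \<Rightarrow> bool" where
  "pattern_less k \<pi> n \<sigma> \<longleftrightarrow>
     k < n \<and> (\<exists>zs. subseq zs (one_line n \<sigma>) \<and> order_isomorphic zs (one_line k \<pi>))"

definition pattern_le :: "nat \<Rightarrow> (nat \<Rightarrow> nat) \<Rightarrow> nat \<Rightarrow> (nat \<Rightarrow> nat) \<Rightarrow> bool" where
  "pattern_le k \<pi> n \<sigma> \<longleftrightarrow> pattern_less k \<pi> n \<sigma> \<or> (k = n \<and> \<pi> = \<sigma>)"

definition cyc_subgroup :: "nat \<Rightarrow> (nat \<Rightarrow> nat) set" where
  "cyc_subgroup n = generate (sym_group n) {cycle_of_list [1..<Suc n]}"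

definition orb :: "nat \<Rightarrow> (nat \<Rightarrow> nat) \<Rightarrow> (nat \<Rightarrow> nat) set" where
  "orb n \<sigma> = {\<tau> \<in> carrier (sym_group n). \<exists>\<rho>\<in>cyc_subgroup n. \<tau> = \<sigma> \<otimes>\<^bsub>sym_group n\<^esub> \<rho>}"

lemma one_line_perm_of: "one_line (length xs) (perm_of xs) = xs"
  by (rule nth_equalityI) (auto simp: one_line_def perm_of_def simp del: upt_Suc)

lemma perm_of_in_sym_group:
  assumes "distinct xs" "set xs = {1..length xs}"
  shows "perm_of xs \<in> carrier (sym_group (length xs))"
proof -
  have "perm_of xs ` {1..length xs} = set (one_line (length xs) (perm_of xs))"
    by (auto simp: one_line_def)
  then have "perm_of xs ` {1..length xs} = {1..length xs}"
    using assms by (simp add: one_line_perm_of)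
  moreover from this have "inj_on (perm_of xs) {1..length xs}"
    by (intro eq_card_imp_inj_on) auto
  ultimately have "bij_betw (perm_of xs) {1..length xs} {1..length xs}"
    by (simp add: bij_betw_def)
  then show ?thesis
    unfolding sym_group_carrier by (intro bij_imp_permutes) (auto simp: perm_of_def)
qed

lemma one_line_inject:
  assumes "\<sigma> \<in> carrier (sym_group n)" "\<tau> \<in> carrier (sym_group n)"
    and "one_line n \<sigma> = one_line n \<tau>"
  shows "\<sigma> = \<tau>"
proof
  fix i
  show "\<sigma> i = \<tau> i"
  proof (cases "i \<in> {1..n}")
    case True
    then show ?thesis using assms(3) by (auto simp: one_line_def simp del: upt_Suc)
  next
    case False
    then show ?thesis using assms(1,2) unfolding sym_group_carrier by (metis permutes_not_in)
  qed
qed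

lemma cyc_subgroup_eq: "cyc_subgroup n = range (\<lambda>k. cycle_of_list [1..<Suc n] ^^ k)"
proof -
  let ?c = "cycle_of_list [1..<Suc n]"
  interpret group "sym_group n" by (rule sym_group_is_group)
  have c: "?c \<in> carrier (sym_group n)"
    using cycle_permutes[of "[1..<Suc n]"]
    by (simp add: sym_group_carrier atLeastLessThanSuc_atLeastAtMost del: upt_Suc)
  have fin: "finite (carrier (sym_group n))"
    by (simp add: sym_group_def finite_permutations)
  have pow: "?c [^]\<^bsub>sym_group n\<^esub> k = ?c ^^ k" for k :: nat
    by (induction k) (simp_all add: sym_group_mult sym_group_one funpow_swap1 fun_eq_iff del: upt_Suc)
  show ?thesis
    unfolding cyc_subgroup_def generate_pow_on_finite_carrier[OF fin c] pow by auto
qed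

text \<open>The orbit consists of the permutations whose one-line notation is a cyclic rotation of the given one.\<close>

lemma mem_orb_iff:
  assumes "\<sigma> \<in> carrier (sym_group n)"
  shows "\<tau> \<in> orb n \<sigma> \<longleftrightarrow>
    \<tau> \<in> carrier (sym_group n) \<and> (\<exists>k. one_line n \<tau> = rotate k (one_line n \<sigma>))"
proof -
  let ?c = "cycle_of_list [1..<Suc n]"
  have rot: "one_line n (\<sigma> \<circ> ?c ^^ k) = rotate k (one_line n \<sigma>)" for k
    using cyclic_rotation[of "[1..<Suc n]" k] unfolding one_line_def
    by (metis distinct_upt map_map rotate_map)
  have closed: "\<sigma> \<circ> ?c ^^ k \<in> carrier (sym_group n)" for k
  proof -
    have "?c permutes {1..n}"
      using cycle_permutes[of "[1..<Suc n]"]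
      by (simp add: atLeastLessThanSuc_atLeastAtMost del: upt_Suc)
    then have "?c ^^ k permutes {1..n}"
      by (induction k) (simp_all add: permutes_compose permutes_id del: upt_Suc)
    then show ?thesis using assms by (simp add: sym_group_carrier permutes_compose)
  qed
  show ?thesis
    unfolding orb_def cyc_subgroup_eq sym_group_mult
    using rot closed one_line_inject by (auto simp del: upt_Suc) metis
qed

end

theory Submission
  imports Defs
begin

text \<open>
  The one-line notation is read cyclically. Both \<open>31425\<close> and \<open>24135\<close> end in their largest
  letter, so that up to rotation they are \<open>5\<close> followed by \<open>3142\<close> and \<open>5\<close> followed by \<open>2413\<close>.
  Rotate \<open>\<sigma>\<close> so that the letter \<open>n\<close> comes first. As \<open>n\<close> exceeds everything after it, it can
  serve as the letter \<open>5\<close>, and it remains to find \<open>3142\<close> or \<open>2413\<close> in the word \<open>L\<close> that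
  follows it, a word in the letters \<open>1, \<dots>, n - 1\<close>.

  If \<open>L\<close> had neither, it would be a separable permutation. A separable word with at least two
  letters, all distinct, is a concatenation of two nonempty words, one of which lies entirely
  below the other (\<open>separable_split\<close>). Splitting repeatedly, always inside a part that still has two letters,
  ends with two neighbouring letters that have no letter of the word strictly between them in
  value (\<open>separable_has_twins\<close>). In \<open>L\<close> these two letters differ by exactly \<open>1\<close>. But
  neighbours in \<open>L\<close> are cyclic neighbours in \<open>\<sigma>\<close>, and in a cylindrical king permutation these
  differ by more than \<open>1\<close>.
\<close>

section \<open>Separable words\<close>

text \<open>The two forbidden patterns are \<open>2413\<close> and \<open>3142\<close>, in this order.\<close>

definition separable :: "'a::linorder list \<Rightarrow> bool" where
  "separable xs \<longleftrightarrow> \<not> (\<exists>a b c d. a < b \<and> b < c \<and> c < d \<and>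
     (subseq [b, d, a, c] xs \<or> subseq [c, a, d, b] xs))"

lemma separable_subseq: "separable ys \<Longrightarrow> subseq xs ys \<Longrightarrow> separable xs"
  unfolding separable_def using subseq_order.order_trans by blast

definition all_rel :: "('a \<Rightarrow> 'a \<Rightarrow> bool) \<Rightarrow> 'a list \<Rightarrow> 'a list \<Rightarrow> bool" where
  "all_rel R xs ys \<longleftrightarrow> (\<forall>x\<in>set xs. \<forall>y\<in>set ys. R x y)"

text \<open>
  The relation \<open>R\<close> stands for \<open><\<close> or \<open>>\<close>, which handles a word that splits as lower part before
  upper part together with its mirror image. The forbidden configuration \<open>x, a, c, b\<close> is \<open>3142\<close>
  for \<open><\<close> and \<open>2413\<close> for \<open>>\<close>. Read ``below'' and ``above'' through \<open>R\<close>. If \<open>x\<close> is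
  neither below all of \<open>B\<close> nor above everything, then \<open>x\<close> lies above \<open>A\<close> and cuts \<open>B\<close> by value; the forbidden configuration forces the elements of
  \<open>B\<close> below \<open>x\<close> to come before those above \<open>x\<close>, so that \<open>B\<close> can be cut there.
\<close>

lemma split_Cons:
  fixes R :: "'a \<Rightarrow> 'a \<Rightarrow> bool"
  assumes total: "\<And>u v. u \<noteq> v \<Longrightarrow> R u v \<or> R v u" and trans: "transp R"
    and AB: "A \<noteq> []" "B \<noteq> []" "all_rel R A B" and x: "x \<notin> set B"
    and avoid: "\<And>a b c. R a b \<Longrightarrow> R b x \<Longrightarrow> R x c \<Longrightarrow> \<not> subseq [x, a, c, b] (x # A @ B)"
  shows "\<exists>C D. C \<noteq> [] \<and> D \<noteq> [] \<and> x # A @ B = C @ D \<and> (all_rel R C D \<or> all_rel R D C)"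
proof (cases "\<exists>b\<in>set B. R b x")
  case False
  then have "all_rel R (x # A) B"
    using total x AB(3) unfolding all_rel_def by (metis set_ConsD)
  then show ?thesis using AB by (metis append_Cons list.distinct(1))
next
  case True
  then have Ax: "R a x" if "a \<in> set A" for a
    using AB(3) that transpD[OF trans] unfolding all_rel_def by blast
  define B1 where "B1 = takeWhile (\<lambda>b. R b x) B"
  define B2 where "B2 = dropWhile (\<lambda>b. R b x) B"
  have B: "B = B1 @ B2" by (simp add: B1_def B2_def)
  have B1: "R b x" if "b \<in> set B1" for b
    using that unfolding B1_def by (metis set_takeWhileD)
  show ?thesis
  proof (cases B2)
    case Nil
    then have "all_rel R (A @ B) [x]" using Ax B B1 unfolding all_rel_def by auto
    then show ?thesis using AB by (intro exI[of _ "[x]"] exI[of _ "A @ B"]) simp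
  next
    case (Cons y B3)
    have "\<not> R y x" using Cons unfolding B2_def by (metis hd_dropWhile list.distinct(1) list.sel(1))
    then have y: "R x y" using total[of x y] x B Cons by auto
    have B2: "R x b" if "b \<in> set B2" for b
    proof (rule ccontr)
      assume "\<not> R x b"
      then have b: "R b x" "b \<in> set B3"
        using total[of x b] that x y B Cons by auto
      obtain a where a: "a \<in> set A" using AB(1) list.set_sel(1) by blast
      have "R a b" using AB(3) a that B unfolding all_rel_def by auto
      moreover have "subseq [x, a, y, b] (x # A @ B)"
      proof -
        have "subseq [b] B3" "subseq [a] A" using b a by (simp_all add: subseq_singleton_left)
        then have "subseq ([a] @ [y, b]) (A @ B2)"
          using Cons by (intro list_emb_append_mono) simp_all
        moreover have "subseq (A @ B2) (A @ B)"
          unfolding B by (intro list_emb_append_mono) auto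
        ultimately show ?thesis using subseq_order.order_trans by fastforce
      qed
      ultimately show False using avoid b y by blast
    qed
    have "all_rel R (x # A @ B1) B2"
      using AB(3) B B1 B2 transpD[OF trans] unfolding all_rel_def by auto blast
    then show ?thesis using B Cons by (intro exI[of _ "x # A @ B1"] exI[of _ B2]) simp
  qed
qed

lemma separable_split:
  fixes xs :: "'a::linorder list"
  assumes "separable xs" "distinct xs" "length xs \<ge> 2"
  shows "\<exists>A B. A \<noteq> [] \<and> B \<noteq> [] \<and> xs = A @ B \<and> (all_rel (<) A B \<or> all_rel (>) A B)"
  using assms
proof (induction xs)
  case (Cons x xs)
  show ?case
  proof (cases "length xs \<ge> 2")
    case True
    have "separable xs" using Cons.prems(1) by (rule separable_subseq) auto
    then obtain A B where AB: "A \<noteq> []" "B \<noteq> []" "xs = A @ B"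
        and rel: "all_rel (<) A B \<or> all_rel (>) A B"
      using Cons.IH Cons.prems(2) True by auto
    have flip: "all_rel (<) D C \<longleftrightarrow> all_rel (>) C D" for C D :: "'a list"
      unfolding all_rel_def by auto
    have sep: "\<not> (\<exists>a b c d. a < b \<and> b < c \<and> c < d \<and>
        (subseq [b, d, a, c] (x # A @ B) \<or> subseq [c, a, d, b] (x # A @ B)))"
      using Cons.prems(1) AB(3) unfolding separable_def by simp
    have x: "x \<notin> set B" using Cons.prems(2) AB(3) by simp
    from rel show ?thesis
    proof
      assume lt: "all_rel (<) A B"
      have "\<exists>C D. C \<noteq> [] \<and> D \<noteq> [] \<and> x # A @ B = C @ D \<and> (all_rel (<) C D \<or> all_rel (<) D C)"
      proof (rule split_Cons[OF _ _ AB(1,2) lt x])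
        fix a b c
        assume "a < b" "b < x" "x < c"
        then show "\<not> subseq [x, a, c, b] (x # A @ B)" using sep by blast
      qed (auto intro: transpI)
      then show ?thesis unfolding AB(3) using flip by blast
    next
      assume gt: "all_rel (>) A B"
      have "\<exists>C D. C \<noteq> [] \<and> D \<noteq> [] \<and> x # A @ B = C @ D \<and> (all_rel (>) C D \<or> all_rel (>) D C)"
      proof (rule split_Cons[OF _ _ AB(1,2) gt x])
        fix a b c
        assume "a > b" "b > x" "x > c"
        then show "\<not> subseq [x, a, c, b] (x # A @ B)" using sep by blast
      qed (auto intro: transpI)
      then show ?thesis unfolding AB(3) using flip by blast
    qed
  next
    case False
    then have "length xs = 1" using Cons.prems(3) by simp
    then obtain y where "xs = [y]" by (auto simp: length_Suc_conv)
    then show ?thesis using Cons.prems(2)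
      by (intro exI[of _ "[x]"] exI[of _ "[y]"]) (auto simp: all_rel_def)
  qed
qed simp

definition twins :: "'a::linorder \<Rightarrow> 'a \<Rightarrow> 'a list \<Rightarrow> bool" where
  "twins p q xs \<longleftrightarrow> (\<exists>us vs. xs = us @ [p, q] @ vs) \<and>
     (\<forall>z\<in>set xs. \<not> (p < z \<and> z < q) \<and> \<not> (q < z \<and> z < p))"

text \<open>
  Letters lying entirely above or entirely below a word do not separate any two of its letters.
\<close>

lemma twins_append:
  assumes "twins p q B" "all_rel (<) A B \<or> all_rel (>) A B" "all_rel (<) C B \<or> all_rel (>) C B"
  shows "twins p q (A @ B @ C)"
proof -
  obtain us vs where B: "B = us @ [p, q] @ vs" using assms(1) unfolding twins_def by blast
  then have "A @ B @ C = (A @ us) @ [p, q] @ (vs @ C)" by simp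
  moreover have "p \<in> set B" "q \<in> set B" using B by auto
  ultimately show ?thesis
    using assms unfolding twins_def all_rel_def by (metis Un_iff order.asym set_append)
qed

lemma separable_has_twins:
  fixes xs :: "'a::linorder list"
  assumes "separable xs" "distinct xs" "length xs \<ge> 2"
  shows "\<exists>p q. twins p q xs"
  using assms
proof (induction xs rule: length_induct)
  case (1 xs)
  obtain A B where AB: "A \<noteq> []" "B \<noteq> []" "xs = A @ B"
      and rel: "all_rel (<) A B \<or> all_rel (>) A B"
    using separable_split 1(2-4) by blast
  have rel': "all_rel (<) B A \<or> all_rel (>) B A" using rel unfolding all_rel_def by auto
  have nil: "all_rel (<) [] D" for D :: "'a list" unfolding all_rel_def by simp
  have sep: "separable A" "separable B"
    using 1(2) AB(3) by (auto elim!: separable_subseq)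
  consider "length A \<ge> 2" | "length B \<ge> 2" | "length A = 1" "length B = 1"
    using AB(1,2) by (cases A; cases B) (auto simp: Suc_le_eq)
  then show ?case
  proof cases
    case 1
    then obtain p q where "twins p q A" using "1.IH" sep AB "1.prems" by force
    then have "twins p q ([] @ A @ B)" using rel' nil by (intro twins_append) auto
    then show ?thesis using AB(3) by auto
  next
    case 2
    then obtain p q where "twins p q B" using "1.IH" sep AB "1.prems" by force
    then have "twins p q (A @ B @ [])" using rel nil by (intro twins_append) auto
    then show ?thesis using AB(3) by auto
  next
    case 3
    then obtain p q where "xs = [p, q]" using AB(3) by (auto simp: length_Suc_conv)
    then have "twins p q xs" unfolding twins_def by auto
    then show ?thesis by blast
  qed
qed

section \<open>Patterns and rotations\<close>

lemma subseq_rotate: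
  assumes "subseq zs (rotate k xs)"
  shows "\<exists>j. subseq (rotate j zs) xs"
proof -
  let ?m = "k mod length xs"
  have "subseq zs (drop ?m xs @ take ?m xs)" using assms by (simp add: rotate_drop_take)
  then obtain us vs where zs: "zs = us @ vs" and "subseq us (drop ?m xs)" "subseq vs (take ?m xs)"
    by (auto simp: subseq_append_iff)
  then have "subseq (vs @ us) (take ?m xs @ drop ?m xs)" by (intro list_emb_append_mono)
  moreover have "vs @ us = rotate (length us) zs" by (simp add: zs rotate_append)
  ultimately show ?thesis by (metis append_take_drop_id)
qed

lemma order_isomorphic_Nil: "order_isomorphic [] []"
  by (simp add: order_isomorphic_def)

lemma order_isomorphic_Cons:
  "order_isomorphic (x # xs) (y # ys) \<longleftrightarrow>
     list_all2 (\<lambda>u v. (x < u \<longleftrightarrow> y < v) \<and> (u < x \<longleftrightarrow> v < y)) xs ys \<and> order_isomorphic xs ys"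
  unfolding order_isomorphic_def list_all2_conv_all_nth by (auto simp: All_less_Suc2)

lemma order_isomorphic_rotate:
  assumes "order_isomorphic xs ys"
  shows "order_isomorphic (rotate k xs) (rotate k ys)"
proof -
  have len: "length xs = length ys" using assms by (simp add: order_isomorphic_def)
  have "(k + i) mod length ys < length ys" if "i < length ys" for i
    using that by (intro mod_less_divisor) linarith
  then show ?thesis
    using assms len unfolding order_isomorphic_def by (simp add: nth_rotate)
qed

text \<open>
  A letter \<open>v\<close> of a permutation of \<open>{1..m}\<close> is determined by the relative order of the
  letters, because exactly \<open>v - 1\<close> letters are smaller than \<open>v\<close>. Hence a pattern that occurs in
  a permutation of its own order is equal to it.
\<close>

lemma nth_eq_rank:
  assumes "distinct xs" "set xs = {1..length xs}" "i < length xs"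
  shows "xs ! i = Suc (card {j. j < length xs \<and> xs ! j < xs ! i})"
proof -
  have i: "xs ! i \<in> {1..length xs}" using assms(2,3) nth_mem by blast
  have "bij_betw ((!) xs) {j. j < length xs \<and> xs ! j < xs ! i} {1..<xs ! i}"
  proof (rule bij_betw_imageI)
    show "inj_on ((!) xs) {j. j < length xs \<and> xs ! j < xs ! i}"
      using assms(1) by (auto simp: inj_on_def nth_eq_iff_index_eq)
    have "v \<in> (!) xs ` {j. j < length xs \<and> xs ! j < xs ! i}" if v: "v \<in> {1..<xs ! i}" for v
    proof -
      have "v \<in> set xs" using v i assms(2) by auto
      then show ?thesis using v by (auto simp: in_set_conv_nth)
    qed
    moreover have "xs ! j \<ge> 1" if "j < length xs" for j
      using that assms(2) nth_mem[of j xs] by auto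
    ultimately show "(!) xs ` {j. j < length xs \<and> xs ! j < xs ! i} = {1..<xs ! i}" by auto
  qed
  from bij_betw_same_card[OF this] show ?thesis using i by simp
qed

lemma order_isomorphic_permutations_eq:
  assumes "order_isomorphic xs ys"
    and "distinct xs" "set xs = {1..length xs}" "distinct ys" "set ys = {1..length ys}"
  shows "xs = ys"
proof (rule nth_equalityI)
  show len: "length xs = length ys" using assms(1) by (simp add: order_isomorphic_def)
  fix i assume i: "i < length xs"
  have "{j. j < length xs \<and> xs ! j < xs ! i} = {j. j < length ys \<and> ys ! j < ys ! i}"
    using assms(1) i len unfolding order_isomorphic_def by auto
  then show "xs ! i = ys ! i"
    using nth_eq_rank[of xs i] nth_eq_rank[of ys i] assms i len by simp
qed

lemma one_line_permutation:
  assumes "\<sigma> \<in> carrier (sym_group n)"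
  shows "length (one_line n \<sigma>) = n" "distinct (one_line n \<sigma>)" "set (one_line n \<sigma>) = {1..n}"
proof -
  have \<sigma>: "\<sigma> permutes {1..n}" using assms by (simp add: sym_group_carrier)
  show "length (one_line n \<sigma>) = n" by (simp add: one_line_def)
  show "distinct (one_line n \<sigma>)"
    using permutes_inj[OF \<sigma>] unfolding one_line_def
    by (auto simp: distinct_map intro: inj_on_subset simp del: upt_Suc)
  show "set (one_line n \<sigma>) = {1..n}"
    using permutes_image[OF \<sigma>]
    by (simp add: one_line_def atLeastLessThanSuc_atLeastAtMost del: upt_Suc)
qed

text \<open>
  Containment read cyclically in \<open>\<sigma>\<close> and in the pattern \<open>ps\<close>: rotating an occurrence back into
  \<open>\<sigma>\<close> rotates the pattern along with it, which stays in the orbit.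
\<close>

lemma orbit_pattern_le:
  assumes \<sigma>: "\<sigma> \<in> carrier (sym_group n)"
    and ps: "distinct ps" "set ps = {1..length ps}" "length ps \<le> n"
    and sub: "subseq zs (rotate k (one_line n \<sigma>))" and iso: "order_isomorphic zs (rotate m ps)"
  shows "\<exists>\<pi>\<in>orb (length ps) (perm_of ps). pattern_le (length ps) \<pi> n \<sigma>"
proof -
  obtain j where j: "subseq (rotate j zs) (one_line n \<sigma>)" using subseq_rotate[OF sub] by blast
  define qs where "qs = rotate (j + m) ps"
  have len: "length qs = length ps" by (simp add: qs_def)
  have qs: "distinct qs" "set qs = {1..length qs}" using ps by (simp_all add: qs_def)
  have line: "one_line (length ps) (perm_of qs) = qs" using one_line_perm_of[of qs] len by simp
  have carrier: "perm_of qs \<in> carrier (sym_group (length ps))"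
    using perm_of_in_sym_group[OF qs] len by simp
  have orb: "perm_of qs \<in> orb (length ps) (perm_of ps)"
    unfolding mem_orb_iff[OF perm_of_in_sym_group[OF ps(1,2)]]
    using carrier line one_line_perm_of[of ps] by (auto simp: qs_def)
  have iso': "order_isomorphic (rotate j zs) qs"
    using order_isomorphic_rotate[OF iso, of j] by (simp add: qs_def rotate_rotate)
  have "pattern_le (length ps) (perm_of qs) n \<sigma>"
  proof (cases "length ps = n")
    case True
    have "length (rotate j zs) = length (one_line n \<sigma>)"
      using iso' len True one_line_permutation(1)[OF \<sigma>] by (simp add: order_isomorphic_def)
    then have "rotate j zs = one_line n \<sigma>" using j subseq_same_length by blast
    then have "one_line n \<sigma> = qs"
      using order_isomorphic_permutations_eq[OF _ _ _ qs] iso' one_line_permutation[OF \<sigma>] by simp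
    then have "perm_of qs = \<sigma>" using one_line_inject carrier \<sigma> line True by simp
    then show ?thesis using True by (simp add: pattern_le_def)
  next
    case False
    then show ?thesis
      using ps(3) j iso' line unfolding pattern_le_def pattern_less_def by auto
  qed
  then show ?thesis using orb by blast
qed

section \<open>Cylindrical king permutations\<close>

lemma CK_cyclic_neighbours:
  assumes "\<sigma> \<in> CK n" and "i < n"
  shows "\<bar>int (one_line n \<sigma> ! (Suc i mod n)) - int (one_line n \<sigma> ! i)\<bar> > 1"
proof -
  have nth: "one_line n \<sigma> ! j = \<sigma> (Suc j)" if "j < n" for j
    using that by (simp add: one_line_def del: upt_Suc)
  show ?thesis
  proof (cases "Suc i < n")
    case True
    then have "Suc i \<in> {1..n - 1}" by auto
    then have "\<bar>int (\<sigma> (Suc i + 1)) - int (\<sigma> (Suc i))\<bar> > 1"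
      using assms(1) unfolding CK_def by blast
    then show ?thesis using True nth[of i] nth[of "Suc i"] by simp
  next
    case False
    then have "Suc i = n" using assms(2) by simp
    then show ?thesis using assms nth[of i] nth[of 0] unfolding CK_def by auto
  qed
qed

lemma CK_rotate_neighbours:
  assumes "\<sigma> \<in> CK n" and "rotate k (one_line n \<sigma>) = us @ [p, q] @ vs"
  shows "\<bar>int q - int p\<bar> > 1"
proof -
  let ?w = "one_line n \<sigma>"
  have len: "length ?w = n" by (simp add: one_line_def)
  have "length (rotate k ?w) = length us + 2 + length vs" using assms(2) by simp
  then have n: "Suc (length us) < n" using len by simp
  define i where "i = (k + length us) mod n"
  have "rotate k ?w ! length us = ?w ! i" "rotate k ?w ! Suc (length us) = ?w ! (Suc i mod n)"
    using n len by (simp_all add: nth_rotate i_def mod_Suc_eq)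
  moreover have "rotate k ?w ! length us = p" "rotate k ?w ! Suc (length us) = q"
    using assms(2) by (simp_all add: nth_append)
  moreover have "i < n" using n by (simp add: i_def)
  ultimately show ?thesis using CK_cyclic_neighbours[OF assms(1), of i] by simp
qed

theorem theorem3p4:
  fixes n :: nat and \<sigma> :: "nat \<Rightarrow> nat"
  assumes "n \<ge> 5" and "\<sigma> \<in> CK n"
  shows "\<exists>\<pi>\<in>orb 5 (perm_of [3, 1, 4, 2, 5]) \<union> orb 5 (perm_of [2, 4, 1, 3, 5]). pattern_le 5 \<pi> n \<sigma>"
proof -
  have \<sigma>: "\<sigma> \<in> carrier (sym_group n)" using assms(2) by (simp add: CK_def)
  note w = one_line_permutation[OF \<sigma>]
  have "n \<in> set (one_line n \<sigma>)" using w(3) assms(1) by simp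
  then obtain P Q where PQ: "one_line n \<sigma> = P @ n # Q" by (meson split_list)
  define L where "L = Q @ P"
  have rot: "rotate (length P) (one_line n \<sigma>) = n # L" by (simp add: PQ rotate_append L_def)
  have dist: "distinct (n # L)" and "set (n # L) = {1..n}" and "length (n # L) = n"
    using w by (simp_all flip: rot)
  then have "set L = {1..n} - {n}"
    by (metis Diff_insert_absorb distinct.simps(2) list.simps(15))
  moreover have "{1..n} - {n} = {1..<n}" by auto
  ultimately have L: "set L = {1..<n}" "distinct L" "length L \<ge> 2"
    using dist \<open>length (n # L) = n\<close> assms(1) by (simp_all only: distinct.simps list.size)
  have "\<not> separable L"
  proof
    assume "separable L"
    then obtain p q where tw: "twins p q L" using separable_has_twins L(2,3) by blast
    then obtain us vs where us: "L = us @ [p, q] @ vs" unfolding twins_def by blast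
    then have "rotate (length P) (one_line n \<sigma>) = (n # us) @ [p, q] @ vs" using rot by simp
    then have far: "\<bar>int q - int p\<bar> > 1" by (rule CK_rotate_neighbours[OF assms(2)])
    have pq: "p \<in> {1..<n}" "q \<in> {1..<n}" using us L(1) by auto
    \<comment> \<open>The successor of the smaller of the two letters would lie between them.\<close>
    have "Suc (min p q) \<in> set L" using pq far L(1) by auto
    moreover have "p < Suc (min p q) \<and> Suc (min p q) < q \<or> q < Suc (min p q) \<and> Suc (min p q) < p"
      using far by linarith
    ultimately show False using tw unfolding twins_def by blast
  qed
  then obtain a b c d where abcd: "a < b" "b < c" "c < d"
      and "subseq [b, d, a, c] L \<or> subseq [c, a, d, b] L"
    unfolding separable_def by blast
  then have sub: "subseq [n, b, d, a, c] (rotate (length P) (one_line n \<sigma>)) \<or>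
      subseq [n, c, a, d, b] (rotate (length P) (one_line n \<sigma>))" (is "?B \<or> ?C")
    unfolding rot by simp
  have "d \<in> set L"
    using \<open>subseq [b, d, a, c] L \<or> subseq [c, a, d, b] L\<close>
    by (metis list.set_intros(1) list.set_intros(2) subseq_order.order_trans
        subseq_singleton_left)
  then have d: "d < n" using L(1) by simp
  have five: "length [u, v, x, y, z :: nat] = 5" for u v x y z by simp
  \<comment> \<open>Rotating by \<open>4\<close> brings the last of five letters to the front.\<close>
  from sub show ?thesis
  proof
    assume ?C
    moreover have "order_isomorphic [n, c, a, d, b] (rotate 4 [3, 1, 4, 2, 5])"
      using abcd d by (simp add: rotate_drop_take order_isomorphic_Cons order_isomorphic_Nil)
    ultimately have "\<exists>\<pi>\<in>orb (length [3, 1, 4, 2, 5::nat]) (perm_of [3, 1, 4, 2, 5]).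
        pattern_le (length [3, 1, 4, 2, 5::nat]) \<pi> n \<sigma>"
      using assms(1) by (intro orbit_pattern_le[OF \<sigma>]) auto
    then show ?thesis unfolding five by blast
  next
    assume ?B
    moreover have "order_isomorphic [n, b, d, a, c] (rotate 4 [2, 4, 1, 3, 5])"
      using abcd d by (simp add: rotate_drop_take order_isomorphic_Cons order_isomorphic_Nil)
    ultimately have "\<exists>\<pi>\<in>orb (length [2, 4, 1, 3, 5::nat]) (perm_of [2, 4, 1, 3, 5]).
        pattern_le (length [2, 4, 1, 3, 5::nat]) \<pi> n \<sigma>"
      using assms(1) by (intro orbit_pattern_le[OF \<sigma>]) auto
    then show ?thesis unfolding five by blast
  qed
qed

end
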